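(* For every integer $k\ge 1$, there exist infinitely many graphs $G$ with exactly $k$ pendant vertices such that $k\ge \chi(G)-1\ge 1$ and $\chi_{la}(G)=k+1$.
   Context: Graphs are finite, simple, connected, and of order at least 3; "infinitely many" is up to isomorphism. $\chi(G)$ is the (usual vertex) chromatic number of $G$. A pendant vertex is a vertex of degree 1. A local antimagic labeling of $G=(V,E)$ is a bijection $f:E\to\{1,\dots,|E|\}$ such that the induced vertex labeling $f^+(u)=\sum f(e)$ (sum over all edges $e$ incident to $u$) satisfies $f^+(x)\ne f^+(y)$ for every pair of adjacent vertices $x,y$. Let $c(f)$ be the number of distinct values of $f^+$. The local antimagic chromatic number is $\chi_{la}(G)=\min\{c(f): f \text{ is a local antimagic labeling of } G\}$. *)

theory Defs
  imports
    "Graph_Theory.Digraph_Component"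
    "Graph_Theory.Digraph_Isomorphism"
    "Graph_Theory.Pair_Digraph"
    "HOL-Library.Extended_Nat"
begin

text \<open>
  A finite simple graph is a \<^locale>\<open>pair_graph\<close>: a finite, loopfree, symmetric digraph without
  parallel arcs, in which each undirected edge is represented by its two opposite arcs.
  Labelings live on the undirected edges, i.e. on the two-element sets of endpoints.
\<close>

definition edges :: "'a pair_pre_digraph \<Rightarrow> 'a set set" where
  "edges G = {{u, v} | u v. (u, v) \<in> parcs G}"

definition incident_edges :: "'a pair_pre_digraph \<Rightarrow> 'a \<Rightarrow> 'a set set" where
  "incident_edges G v = {e \<in> edges G. v \<in> e}"

definition pendant_vertices :: "'a pair_pre_digraph \<Rightarrow> 'a set" where
  "pendant_vertices G = {v \<in> pverts G. card (incident_edges G v) = 1}"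

definition proper_vertex_coloring :: "'a pair_pre_digraph \<Rightarrow> ('a \<Rightarrow> nat) \<Rightarrow> bool" where
  "proper_vertex_coloring G c \<longleftrightarrow> (\<forall>(u, v) \<in> parcs G. c u \<noteq> c v)"

definition chromatic_number :: "'a pair_pre_digraph \<Rightarrow> nat" where
  "chromatic_number G =
     (LEAST n. \<exists>c. proper_vertex_coloring G c \<and> c ` pverts G \<subseteq> {..<n})"

definition induced_label :: "'a pair_pre_digraph \<Rightarrow> ('a set \<Rightarrow> nat) \<Rightarrow> 'a \<Rightarrow> nat" where
  "induced_label G f u = (\<Sum>e \<in> incident_edges G u. f e)"

definition local_antimagic_labeling :: "'a pair_pre_digraph \<Rightarrow> ('a set \<Rightarrow> nat) \<Rightarrow> bool" where
  "local_antimagic_labeling G f \<longleftrightarrow>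
     bij_betw f (edges G) {1..card (edges G)} \<and>
     (\<forall>(x, y) \<in> parcs G. induced_label G f x \<noteq> induced_label G f y)"

definition num_induced_labels :: "'a pair_pre_digraph \<Rightarrow> ('a set \<Rightarrow> nat) \<Rightarrow> nat" where
  "num_induced_labels G f = card (induced_label G f ` pverts G)"

text \<open>
  An infimum in \<^typ>\<open>enat\<close> is a minimum whenever the set is nonempty; a graph without any local
  antimagic labeling gets the value \<open>\<infinity>\<close>, so a finite value always comes from a labeling.
\<close>

definition local_antimagic_chromatic_number :: "'a pair_pre_digraph \<Rightarrow> enat" where
  "local_antimagic_chromatic_number G =
     (INF f \<in> {f. local_antimagic_labeling G f}. enat (num_induced_labels G f))"

end

theory Submission
  imports Defs
begin

text \<open>
  Lower bound. In any local antimagic labeling of a graph with \<open>q\<close> edges, a pendant vertex receives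
  the label of its only edge, so \<open>k\<close> pendant vertices show \<open>k\<close> different values, all at most \<open>q\<close>.
  The edge labeled \<open>q\<close> has an end of degree at least 2, and that end receives more than \<open>q\<close>.
  Hence at least \<open>k + 1\<close> values occur (\<open>pendants_less_num_induced_labels\<close>).

  Upper bound. The graphs attaining it are built from their labeling. Two nonadjacent hubs are both
  joined to \<open>r\<close> inner leaves, whose two edges carry labels \<open>l\<close> and \<open>2r + 1 - l\<close>, and \<open>k\<close> pendant
  leaves hang from the hubs on edges labeled \<open>2r + 1, \<dots>, 2r + k\<close>. Every inner leaf receives
  \<open>2r + 1\<close>, which is already the value of a pendant leaf; so if moreover the two hubs receive
  the same sum, exactly \<open>k + 1\<close> values occur. The graphs are bipartite, so \<open>\<chi> = 2\<close>.

  It remains to balance the hubs for infinitely many \<open>r\<close> (\<open>balanced_hubs_exists\<close>). An inner leaf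
  changes the difference of the hub sums by \<open>2r + 1 - 2l\<close> up to sign, so the inner leaves contribute
  the odd numbers \<open>1, 3, \<dots>, 2r - 1\<close> with signs that can be chosen freely. Alternating the sides of the pendant
  leaves lets them contribute \<open>k div 2\<close>, up to one further odd number \<open>2r + 1\<close> when \<open>k\<close> is odd.
  Signed consecutive odd numbers can sum to \<open>-(k div 2)\<close>: alternating signs on the first
  \<open>k div 2\<close> of them give this value, and blocks of four with signs \<open>+ - - +\<close> cancel, which leaves
  the number of blocks free.
\<close>

section \<open>Pendant vertices force many induced labels\<close>

text \<open>
  The hypothesis on the ends of edges holds in every connected graph of order at least 3. It is used
  twice: to keep two pendant vertices from sharing an edge, and to find an end of the edge with the
  largest label whose value exceeds that label.
\<close>

lemma pendants_less_num_induced_labels: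
  assumes "pair_graph G" and f: "local_antimagic_labeling G f"
    and ne: "edges G \<noteq> {}"
    and nonpendant_end: "\<And>e. e \<in> edges G \<Longrightarrow> \<exists>v\<in>e. v \<notin> pendant_vertices G"
  shows "card (pendant_vertices G) < num_induced_labels G f"
proof -
  interpret pair_graph G by fact
  let ?q = "card (edges G)" and ?P = "pendant_vertices G" and ?g = "induced_label G f"
  have bij: "bij_betw f (edges G) {1..?q}"
    using f by (simp add: local_antimagic_labeling_def)
  have "edges G = (\<lambda>(u, v). {u, v}) ` parcs G"
    by (auto simp: edges_def)
  then have finE: "finite (edges G)" by simp
  have finI: "finite (incident_edges G v)" for v
    using finE by (simp add: incident_edges_def)
  have finP: "finite ?P" by (simp add: pendant_vertices_def)
  have edge_verts: "e \<subseteq> pverts G" if "e \<in> edges G" for e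
    using that by (auto simp: edges_def dest: in_arcsD1 in_arcsD2)
  have pendant: "\<exists>e\<in>edges G. v \<in> e \<and> ?g v = f e" if "v \<in> ?P" for v
  proof -
    have "card (incident_edges G v) = 1" using that by (simp add: pendant_vertices_def)
    then obtain e where "incident_edges G v = {e}" by (rule card_1_singletonE)
    then show ?thesis by (auto simp: incident_edges_def induced_label_def)
  qed
  have small: "?g v \<le> ?q" if "v \<in> ?P" for v
    using pendant[OF that] bij by (auto simp: bij_betw_def)
  have inj: "inj_on ?g ?P"
  proof (rule inj_onI, rule ccontr)
    fix v w assume vw: "v \<in> ?P" "w \<in> ?P" "?g v = ?g w" "v \<noteq> w"
    obtain e where e: "e \<in> edges G" "v \<in> e" "?g v = f e" using pendant[OF vw(1)] by blast
    obtain e' where e': "e' \<in> edges G" "w \<in> e'" "?g w = f e'" using pendant[OF vw(2)] by blast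
    have "e = e'"
      using bij e e' vw(3) by (metis bij_betw_inv_into_left)
    then have "e = {v, w}"
      using e e' vw(4) by (auto simp: edges_def)
    then show False using nonpendant_end[OF e(1)] vw by auto
  qed
  have "?q \<in> {1..?q}" using ne finE by (simp add: Suc_le_eq card_gt_0_iff)
  then obtain e where e: "e \<in> edges G" "f e = ?q"
    using bij by (metis bij_betwE bij_betw_inv_into bij_betw_inv_into_right)
  obtain v where v: "v \<in> e" "v \<notin> ?P" using nonpendant_end[OF e(1)] by blast
  have vG: "v \<in> pverts G" using edge_verts e v by blast
  have "e \<in> incident_edges G v" using e v by (simp add: incident_edges_def)
  moreover have "card (incident_edges G v) \<noteq> 1"
    using v vG by (simp add: pendant_vertices_def)
  ultimately obtain e' where e': "e' \<in> incident_edges G v" "e' \<noteq> e"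
    by (metis finI is_singletonI' is_singleton_altdef empty_iff)
  have "f e' \<ge> 1"
    using e' bij by (auto simp: incident_edges_def bij_betw_def)
  then have "?q < f e + f e'" using e by simp
  also have "\<dots> = sum f {e, e'}" using e' by simp
  also have "\<dots> \<le> ?g v"
    unfolding induced_label_def
    using finI e' \<open>e \<in> incident_edges G v\<close> by (intro sum_mono2) auto
  finally have big: "?q < ?g v" .
  have "?g v \<notin> ?g ` ?P" using small big by fastforce
  then have "card (insert (?g v) (?g ` ?P)) = Suc (card ?P)"
    using finP card_image[OF inj] by simp
  moreover have "card (insert (?g v) (?g ` ?P)) \<le> card (?g ` pverts G)"
    using vG by (intro card_mono) (auto simp: pendant_vertices_def)
  ultimately show ?thesis by (simp add: num_induced_labels_def)
qed

section \<open>Chromatic number of bipartite graphs; isomorphism and order\<close>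

lemma chromatic_number_eq_2:
  assumes c: "proper_vertex_coloring G c" "c ` pverts G \<subseteq> {..<2}"
    and uv: "(u, v) \<in> parcs G" "u \<in> pverts G" "v \<in> pverts G"
  shows "chromatic_number G = 2"
  unfolding chromatic_number_def
proof (rule Least_equality)
  show "\<exists>c. proper_vertex_coloring G c \<and> c ` pverts G \<subseteq> {..<2}" using c by blast
next
  fix n assume "\<exists>c. proper_vertex_coloring G c \<and> c ` pverts G \<subseteq> {..<n}"
  then obtain d where d: "proper_vertex_coloring G d" "d ` pverts G \<subseteq> {..<n}" by blast
  then have "d u \<noteq> d v" "d u < n" "d v < n"
    using uv by (auto simp: proper_vertex_coloring_def)
  then show "2 \<le> n" by linarith
qed

lemma digraph_iso_card_verts:
  assumes "digraph_iso G H"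
  shows "card (verts H) = card (verts G)"
  using assms by (auto simp: digraph_iso_def pre_digraph.digraph_isomorphism_def card_image)

section \<open>Graphs with two balanced hubs\<close>

text \<open>
  A graph is encoded by the set \<open>S\<close> of labels whose edges lie at hub 0; all other labels
  lie at hub 1. That \<open>S\<close> separates \<open>l\<close> from \<open>2 * r + 1 - l\<close> makes the two edges of
  an inner leaf end at different hubs.
\<close>

locale balanced_hubs =
  fixes r k :: nat and S :: "nat set"
  assumes r: "r \<ge> 2" and k: "k \<ge> 1"
    and split: "\<And>l. 1 \<le> l \<Longrightarrow> l \<le> 2 * r \<Longrightarrow> 2 * r + 1 - l \<in> S \<longleftrightarrow> l \<notin> S"
    and balance: "\<Sum>({1..2 * r + k} \<inter> S) = \<Sum>({1..2 * r + k} - S)"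
begin

definition hub :: "nat \<Rightarrow> nat" where
  "hub l = (if l \<in> S then 0 else 1)"

text \<open>
  An inner leaf is named by the larger of its two labels, a pendant leaf by its only label: for
  \<open>l > 2 * r\<close> the truncated difference is 0. As \<open>r \<ge> 2\<close>, no leaf has the name of a hub.
\<close>

definition leaf :: "nat \<Rightarrow> nat" where
  "leaf l = max l (2 * r + 1 - l)"

definition hub_graph :: "nat pair_pre_digraph" where
  "hub_graph = \<lparr>pverts = {0, 1} \<union> {r + 1..2 * r + k},
     parcs = (\<Union>l \<in> {1..2 * r + k}. {(hub l, leaf l), (leaf l, hub l)})\<rparr>"

definition edge :: "nat \<Rightarrow> nat set" where
  "edge l = {hub l, leaf l}"

definition label :: "nat set \<Rightarrow> nat" where
  "label = the_inv_into {1..2 * r + k} edge"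

definition labels_at :: "nat \<Rightarrow> nat set" where
  "labels_at v = {l \<in> {1..2 * r + k}. v \<in> edge l}"

lemma hub_le: "hub l \<le> 1"
  by (simp add: hub_def)

lemma leaf_bounds:
  assumes "l \<in> {1..2 * r + k}"
  shows "r + 1 \<le> leaf l" "leaf l \<le> 2 * r + k"
  using assms k by (auto simp: leaf_def)

lemma leaf_gt_1: "l \<in> {1..2 * r + k} \<Longrightarrow> 1 < leaf l"
  using leaf_bounds[of l] r by linarith

lemma edges_hub_graph: "edges hub_graph = edge ` {1..2 * r + k}"
  unfolding edges_def hub_graph_def edge_def by (auto simp: insert_commute)

lemma inj_edge: "inj_on edge {1..2 * r + k}"
proof (rule inj_onI)
  fix l m assume lm: "l \<in> {1..2 * r + k}" "m \<in> {1..2 * r + k}" "edge l = edge m"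
  have "leaf l \<noteq> hub m" "leaf m \<noteq> hub l"
    using leaf_gt_1[OF lm(1)] leaf_gt_1[OF lm(2)] hub_le[of l] hub_le[of m] by linarith+
  then have eq: "hub l = hub m" "leaf l = leaf m"
    using lm(3) by (auto simp: edge_def doubleton_eq_iff)
  show "l = m"
  proof (rule ccontr)
    assume "l \<noteq> m"
    then have "m = 2 * r + 1 - l" "l \<le> 2 * r"
      using eq(2) lm(1,2) by (auto simp: leaf_def max_def split: if_splits)
    then show False
      using split[of l] eq(1) lm(1) by (auto simp: hub_def split: if_splits)
  qed
qed

lemma card_edges: "card (edges hub_graph) = 2 * r + k"
  using card_image[OF inj_edge] by (simp add: edges_hub_graph)

lemma incident_edges_hub_graph: "incident_edges hub_graph v = edge ` labels_at v"
  by (auto simp: incident_edges_def edges_hub_graph labels_at_def)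

lemma inj_edge_labels_at: "inj_on edge (labels_at v)"
  by (rule inj_on_subset[OF inj_edge]) (auto simp: labels_at_def)

lemma card_incident_edges: "card (incident_edges hub_graph v) = card (labels_at v)"
  by (simp add: incident_edges_hub_graph card_image inj_edge_labels_at)

lemma induced_label_hub_graph: "induced_label hub_graph label v = \<Sum>(labels_at v)"
proof -
  have "induced_label hub_graph label v = (\<Sum>l\<in>labels_at v. label (edge l))"
    by (simp add: induced_label_def incident_edges_hub_graph sum.reindex[OF inj_edge_labels_at])
  also have "\<dots> = \<Sum>(labels_at v)"
    by (rule sum.cong) (auto simp: label_def labels_at_def the_inv_into_f_f[OF inj_edge] simp del: One_nat_def)
  finally show ?thesis .
qed

lemma labels_at_0: "labels_at 0 = {1..2 * r + k} \<inter> S"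
  using leaf_gt_1 by (fastforce simp: labels_at_def edge_def hub_def split: if_splits)

lemma labels_at_1: "labels_at 1 = {1..2 * r + k} - S"
  using leaf_gt_1 by (fastforce simp: labels_at_def edge_def hub_def split: if_splits)

lemma labels_at_inner:
  assumes "r + 1 \<le> v" "v \<le> 2 * r"
  shows "labels_at v = {v, 2 * r + 1 - v}"
proof -
  have "v \<noteq> hub l" for l using hub_le[of l] assms r by linarith
  then show ?thesis
    using assms by (auto simp: labels_at_def edge_def leaf_def max_def split: if_splits)
qed

lemma labels_at_outer:
  assumes "2 * r + 1 \<le> v" "v \<le> 2 * r + k"
  shows "labels_at v = {v}"
proof -
  have "v \<noteq> hub l" for l using hub_le[of l] assms r by linarith
  then show ?thesis
    using assms by (auto simp: labels_at_def edge_def leaf_def max_def split: if_splits)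
qed

lemma vertex_cases:
  assumes "v \<in> pverts hub_graph"
  obtains "v \<le> 1" | "r + 1 \<le> v" "v \<le> 2 * r" | "2 * r + 1 \<le> v" "v \<le> 2 * r + k"
  using assms by (fastforce simp: hub_graph_def)

lemma pair_graph_hub_graph: "pair_graph hub_graph"
proof
  fix e assume e: "e \<in> parcs hub_graph"
  then obtain l where l: "l \<in> {1..2 * r + k}" "e = (hub l, leaf l) \<or> e = (leaf l, hub l)"
    by (auto simp: hub_graph_def)
  have "hub l \<in> pverts hub_graph" "leaf l \<in> pverts hub_graph" "hub l \<noteq> leaf l"
    using hub_le[of l] leaf_bounds[OF l(1)] leaf_gt_1[OF l(1)] by (auto simp: hub_graph_def)
  then show "fst e \<in> pverts hub_graph" "snd e \<in> pverts hub_graph" "fst e \<noteq> snd e"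
    using l(2) by auto
next
  show "symmetric (with_proj hub_graph)"
    by (auto simp: symmetric_conv hub_graph_def)
qed (auto simp: hub_graph_def)

text \<open>
  The inner leaf carrying the labels 1 and \<open>2 * r\<close> serves as the meeting point of all paths in the
  proof of connectedness.
\<close>

lemma joined_to_both_hubs:
  assumes "i \<le> 1"
  shows "(i, 2 * r) \<in> parcs hub_graph"
proof -
  have "1 \<in> S \<longleftrightarrow> 2 * r \<notin> S" using split[of "2 * r"] r by simp
  then have "hub 1 = i \<or> hub (2 * r) = i" using assms by (auto simp: hub_def)
  moreover have "leaf 1 = 2 * r" "leaf (2 * r) = 2 * r" using r by (auto simp: leaf_def)
  ultimately show ?thesis using r by (force simp: hub_graph_def)
qed

lemma connected_hub_graph: "Digraph_Component.connected (with_proj hub_graph)"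
proof -
  interpret pair_graph hub_graph by (rule pair_graph_hub_graph)
  have hub_reach: "i \<rightarrow>\<^sup>*\<^bsub>with_proj hub_graph\<^esub> (2 * r)" if "i \<le> 1" for i
    using joined_to_both_hubs[OF that] by (intro reachable_adjI) simp
  have reach: "v \<rightarrow>\<^sup>*\<^bsub>with_proj hub_graph\<^esub> (2 * r)" if v: "v \<in> pverts hub_graph" for v
  proof (cases "v \<le> 1")
    case False
    then have vl: "v \<in> {1..2 * r + k}" "leaf v = v"
      using v by (auto simp: hub_graph_def leaf_def)
    then have "(v, hub v) \<in> parcs hub_graph"
      by (force simp: hub_graph_def)
    then show ?thesis
      by (intro adj_reachable_trans[OF _ hub_reach[OF hub_le]]) simp
  qed (rule hub_reach)
  have "strongly_connected (with_proj hub_graph)"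
  proof
    fix u v assume "u \<in> verts (with_proj hub_graph)" "v \<in> verts (with_proj hub_graph)"
    then show "u \<rightarrow>\<^sup>*\<^bsub>with_proj hub_graph\<^esub> v"
      using reach[of u] symmetric_reachable'[OF reach[of v]]
      by (auto intro: reachable_trans)
  qed (auto simp: hub_graph_def)
  then show ?thesis
    by (auto simp: connected_def strongly_connected_def intro: reachable_mk_symmetricI)
qed

lemma card_pverts: "card (pverts hub_graph) = r + k + 2"
  using r by (simp add: hub_graph_def)

text \<open>
  A hub is adjacent to all \<open>r \<ge> 2\<close> inner leaves; the leaves \<open>2 * r\<close> and \<open>2 * r - 1\<close> suffice here.
\<close>

lemma hub_not_pendant:
  assumes "v \<le> 1"
  shows "card (labels_at v) \<noteq> 1"
proof
  assume one: "card (labels_at v) = 1"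
  have inj: "inj_on leaf (labels_at v)"
  proof (rule inj_onI)
    fix l m assume lm: "l \<in> labels_at v" "m \<in> labels_at v" "leaf l = leaf m"
    then have *: "l \<in> {1..2 * r + k}" "m \<in> {1..2 * r + k}" "v \<in> edge l" "v \<in> edge m"
      by (auto simp: labels_at_def)
    then have "hub l = v" "hub m = v"
      using leaf_gt_1[of l] leaf_gt_1[of m] assms by (auto simp: edge_def)
    then have "edge l = edge m" using lm(3) by (simp add: edge_def)
    then show "l = m" using *(1,2) inj_edge by (blast dest: inj_onD)
  qed
  have "w \<in> leaf ` labels_at v" if w: "w = 2 * r \<or> w = 2 * r - 1" for w
  proof -
    have "2 * r + 1 - w \<in> S \<longleftrightarrow> w \<notin> S" using split[of w] w r by auto
    then have "hub (2 * r + 1 - w) = v \<or> hub w = v" using assms by (auto simp: hub_def)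
    moreover have leaf_w: "leaf (2 * r + 1 - w) = w" "leaf w = w"
      using w r by (auto simp: leaf_def)
    moreover have "w \<in> {1..2 * r + k}" "2 * r + 1 - w \<in> {1..2 * r + k}" using w r by auto
    ultimately have "2 * r + 1 - w \<in> labels_at v \<or> w \<in> labels_at v"
      unfolding labels_at_def edge_def by blast
    then show ?thesis using leaf_w imageI[of _ "labels_at v" leaf] by metis
  qed
  then have "{2 * r, 2 * r - 1} \<subseteq> leaf ` labels_at v" by simp
  then have "card {2 * r, 2 * r - 1} \<le> card (leaf ` labels_at v)"
    by (rule card_mono[rotated]) (simp add: labels_at_def)
  then show False using one r by (simp add: card_image[OF inj])
qed

lemma pendant_vertices_hub_graph: "pendant_vertices hub_graph = {2 * r + 1..2 * r + k}"
proof (intro equalityI subsetI)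
  fix v assume "v \<in> pendant_vertices hub_graph"
  then have v: "v \<in> pverts hub_graph" "card (labels_at v) = 1"
    by (auto simp: pendant_vertices_def card_incident_edges)
  show "v \<in> {2 * r + 1..2 * r + k}"
    using v(1)
  proof (cases rule: vertex_cases)
    case 1 then show ?thesis using hub_not_pendant v(2) by blast
  next
    case 2
    then have "v \<noteq> 2 * r + 1 - v" by linarith
    then show ?thesis using labels_at_inner[OF 2] v(2) by simp
  qed simp
next
  fix v assume "v \<in> {2 * r + 1..2 * r + k}"
  then show "v \<in> pendant_vertices hub_graph"
    using labels_at_outer[of v]
    by (simp add: pendant_vertices_def card_incident_edges) (simp add: hub_graph_def)
qed

lemma chromatic_number_hub_graph: "chromatic_number hub_graph = 2"
proof (rule chromatic_number_eq_2)
  show "proper_vertex_coloring hub_graph (\<lambda>v. if v \<le> 1 then 0 else 1)"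
    using hub_le leaf_gt_1 by (fastforce simp: proper_vertex_coloring_def hub_graph_def)
  show "(0, 2 * r) \<in> parcs hub_graph" by (rule joined_to_both_hubs) simp
qed (use r in \<open>auto simp: hub_graph_def\<close>)

text \<open>
  Both hubs receive half of the sum of all labels, that is \<open>q * (q + 1) / 4\<close> for \<open>q\<close> edges. This
  exceeds \<open>q\<close> because \<open>q \<ge> 5\<close>, and so differs from the value of every leaf.
\<close>

lemma hub_sum_large: "2 * r + k < \<Sum>({1..2 * r + k} \<inter> S)"
proof -
  let ?q = "2 * r + k"
  have "\<Sum>{1..?q} = \<Sum>({1..?q} \<inter> S) + \<Sum>({1..?q} - S)"
    by (rule sum.Int_Diff) simp
  then have "4 * \<Sum>({1..?q} \<inter> S) = 2 * \<Sum>{1..?q}" using balance by simp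
  also have "\<dots> = ?q * (?q + 1)"
    using double_gauss_sum[where 'a = nat, of ?q] by (simp add: sum.atLeast_Suc_atMost)
  also have "\<dots> > 4 * ?q"
    using r k mult_strict_left_mono[of 4 "?q + 1" ?q] by (simp add: mult.commute)
  finally show ?thesis by simp
qed

lemma induced_label_at_hub:
  "v \<le> 1 \<Longrightarrow> induced_label hub_graph label v = \<Sum>({1..2 * r + k} \<inter> S)"
  using balance labels_at_0 labels_at_1
  by (cases v) (auto simp: induced_label_hub_graph simp flip: One_nat_def)

lemma induced_label_at_leaf:
  assumes "v \<in> pverts hub_graph" "1 < v"
  shows "induced_label hub_graph label v \<in> {2 * r + 1..2 * r + k}"
  using assms(1)
proof (cases rule: vertex_cases)
  case 2
  then have "v \<noteq> 2 * r + 1 - v" by linarith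
  then show ?thesis using 2 k by (simp add: induced_label_hub_graph labels_at_inner)
next
  case 3
  then show ?thesis by (simp add: induced_label_hub_graph labels_at_outer)
qed (use assms in simp)

lemma local_antimagic_label: "local_antimagic_labeling hub_graph label"
proof -
  interpret pair_graph hub_graph by (rule pair_graph_hub_graph)
  have "bij_betw edge {1..2 * r + k} (edges hub_graph)"
    using inj_edge by (simp only: bij_betw_def edges_hub_graph)
  then have "bij_betw label (edges hub_graph) {1..card (edges hub_graph)}"
    unfolding label_def card_edges by (rule bij_betw_the_inv_into)
  moreover have "induced_label hub_graph label x \<noteq> induced_label hub_graph label y"
    if xy: "(x, y) \<in> parcs hub_graph" for x y
  proof -
    have "x \<le> 1 \<and> 1 < y \<or> y \<le> 1 \<and> 1 < x"
      using xy hub_le leaf_gt_1 by (fastforce simp: hub_graph_def)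
    moreover have "x \<in> pverts hub_graph" "y \<in> pverts hub_graph"
      using xy by (auto dest: in_arcsD1 in_arcsD2)
    ultimately show ?thesis
      using induced_label_at_hub[of x] induced_label_at_hub[of y]
        induced_label_at_leaf[of x] induced_label_at_leaf[of y] hub_sum_large by fastforce
  qed
  ultimately show ?thesis by (auto simp: local_antimagic_labeling_def)
qed

lemma num_induced_labels_le: "num_induced_labels hub_graph label \<le> k + 1"
proof -
  let ?C = "insert (\<Sum>({1..2 * r + k} \<inter> S)) {2 * r + 1..2 * r + k}"
  have "induced_label hub_graph label ` pverts hub_graph \<subseteq> ?C"
  proof (intro image_subsetI)
    fix v assume "v \<in> pverts hub_graph"
    then show "induced_label hub_graph label v \<in> ?C"
      using induced_label_at_hub[of v] induced_label_at_leaf[of v] by (cases "v \<le> 1") simp_all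
  qed
  then have "num_induced_labels hub_graph label \<le> card ?C"
    unfolding num_induced_labels_def by (intro card_mono) auto
  also have "\<dots> \<le> k + 1"
    using card_insert_le_m1[of "k + 1" "{2 * r + 1..2 * r + k}"] by simp
  finally show ?thesis .
qed

lemma local_antimagic_chromatic_number_hub_graph:
  "local_antimagic_chromatic_number hub_graph = enat (k + 1)"
  unfolding local_antimagic_chromatic_number_def
proof (rule antisym)
  show "(INF f\<in>{f. local_antimagic_labeling hub_graph f}. enat (num_induced_labels hub_graph f))
      \<le> enat (k + 1)"
    using local_antimagic_label num_induced_labels_le by (intro INF_lower2[of label]) auto
next
  show "enat (k + 1) \<le>
      (INF f\<in>{f. local_antimagic_labeling hub_graph f}. enat (num_induced_labels hub_graph f))"
  proof (rule INF_greatest)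
    fix f assume "f \<in> {f. local_antimagic_labeling hub_graph f}"
    moreover have "edges hub_graph \<noteq> {}" using k by (simp add: edges_hub_graph)
    moreover have "\<exists>v\<in>e. v \<notin> pendant_vertices hub_graph" if "e \<in> edges hub_graph" for e
    proof -
      obtain l where "hub l \<in> e" using \<open>e \<in> edges hub_graph\<close> by (auto simp: edges_hub_graph edge_def)
      moreover have "hub l \<notin> pendant_vertices hub_graph"
        using hub_le[of l] r by (simp add: pendant_vertices_hub_graph)
      ultimately show ?thesis by blast
    qed
    ultimately have "card (pendant_vertices hub_graph) < num_induced_labels hub_graph f"
      by (intro pendants_less_num_induced_labels pair_graph_hub_graph) auto
    then show "enat (k + 1) \<le> enat (num_induced_labels hub_graph f)"
      by (simp add: pendant_vertices_hub_graph)
  qed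
qed

end

section \<open>Balancing the hubs\<close>

text \<open>
  The number of summands is \<open>h\<close> plus an arbitrary multiple of 4 because four consecutive odd numbers
  cancel with signs \<open>+ - - +\<close>; this freedom makes the family of graphs infinite.
\<close>

lemma signed_odd_sum:
  fixes h t :: nat
  shows "\<exists>e :: nat \<Rightarrow> int. (\<forall>i. e i = 1 \<or> e i = -1) \<and>
    (\<Sum>i<h + 4 * t. e i * (2 * int i + 1)) = - int h"
proof (induction t)
  case 0
  have *: "(\<Sum>i<n. (-1) ^ i * (2 * int i + 1)) = - ((-1) ^ n * int n)" for n
    by (induction n) (auto simp: algebra_simps)
  have "(\<Sum>i<h. (-1) ^ (i + h) * (2 * int i + 1))
      = (-1) ^ h * (\<Sum>i<h. (-1) ^ i * (2 * int i + 1))"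
    by (simp add: sum_distrib_left power_add mult_ac)
  also have "\<dots> = - int h"
    unfolding * by (simp flip: power_add mult.assoc mult_2)
  finally have "(\<Sum>i<h. (-1) ^ (i + h) * (2 * int i + 1)) = - int h" .
  then show ?case
    by (intro exI[of _ "\<lambda>i. (-1) ^ (i + h)"]) (auto simp: minus_one_power_iff)
next
  case (Suc t)
  let ?n = "h + 4 * t"
  obtain e :: "nat \<Rightarrow> int" where e: "\<forall>i. e i = 1 \<or> e i = -1"
      "(\<Sum>i<?n. e i * (2 * int i + 1)) = - int h"
    using Suc by blast
  define e' where "e' i = (if i < ?n then e i else if i \<in> {?n, ?n + 3} then 1 else -1)" for i
  have "h + 4 * Suc t = Suc (Suc (Suc (Suc ?n)))" by simp
  then have "(\<Sum>i<h + 4 * Suc t. e' i * (2 * int i + 1)) = (\<Sum>i<?n. e' i * (2 * int i + 1))"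
    by (simp only: sum.lessThan_Suc) (simp add: e'_def)
  also have "\<dots> = (\<Sum>i<?n. e i * (2 * int i + 1))"
    by (rule sum.cong) (auto simp: e'_def)
  finally show ?case
    using e by (intro exI[of _ e']) (auto simp: e'_def)
qed

text \<open>
  The summands group into \<open>h\<close> pairs of neighbours \<open>- int l + int (l + 1)\<close>.
\<close>

lemma alternating_tail:
  "(\<Sum>l = Suc m..m + 2 * h. (-1) ^ (l + m) * int l) = int h"
proof (induction h)
  case (Suc h)
  have "m + 2 * Suc h = Suc (Suc (m + 2 * h))" by simp
  then show ?case using Suc.IH by (simp only: sum.nat_ivl_Suc') (simp add: power_add)
qed simp

lemma balanced_hubs_exists:
  assumes "k \<ge> 1"
  shows "\<exists>r\<ge>N. \<exists>S. balanced_hubs r k S"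
proof -
  \<comment> \<open>For odd \<open>k\<close> the first pendant edge, labeled \<open>2 * r + 1\<close>, joins the odd numbers contributed by the
    inner leaves, so that there are \<open>r + c\<close> of them; the other \<open>2 * h\<close> pendant edges alternate.\<close>
  define h c where "h = k div 2" and "c = k mod 2"
  have k_eq: "k = 2 * h + c" and c: "c = 0 \<or> c = 1" by (auto simp: h_def c_def)
  define t where "t = N + 1"
  define r where "r = h + 4 * t - c"
  have r: "r + c = h + 4 * t" "r \<ge> N" "r \<ge> 2" using c by (auto simp: r_def t_def)
  obtain e :: "nat \<Rightarrow> int" where e: "\<And>i. e i = 1 \<or> e i = -1"
      "(\<Sum>i<r + c. e i * (2 * int i + 1)) = - int h"
    using signed_odd_sum[of h t] r(1) by auto
  \<comment> \<open>The sign of a label tells its hub. The labels \<open>r - i\<close> and \<open>r + 1 + i\<close> meet in an inner leaf and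
    differ by \<open>2 * i + 1\<close>, hence get the signs \<open>- e i\<close> and \<open>e i\<close>.\<close>
  define \<sigma> where "\<sigma> l = (if l \<le> r then - e (r - l) else if l \<le> 2 * r + c then e (l - r - 1)
      else (-1) ^ (l + (2 * r + c)))" for l
  have \<sigma>: "\<sigma> l = 1 \<or> \<sigma> l = -1" for l
    using e(1)[of "r - l"] e(1)[of "l - r - 1"] by (auto simp: \<sigma>_def minus_one_power_iff)
  define S where "S = {l. \<sigma> l = 1}"
  let ?L = "{1..2 * r + k}"
  have pairs: "(\<Sum>l = 1..2 * r. \<sigma> l * int l) = (\<Sum>i<r. e i * (2 * int i + 1))"
  proof -
    have "(\<Sum>l = 1..r. \<sigma> l * int l) = (\<Sum>i<r. - e i * int (r - i))"
      by (rule sum.reindex_bij_witness[of _ "\<lambda>i. r - i" "\<lambda>l. r - l"]) (auto simp: \<sigma>_def)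
    moreover have "(\<Sum>l = r + 1..2 * r. \<sigma> l * int l) = (\<Sum>i<r. e i * int (r + 1 + i))"
      by (rule sum.reindex_bij_witness[of _ "\<lambda>i. r + 1 + i" "\<lambda>l. l - r - 1"])
        (auto simp: \<sigma>_def)
    moreover have "(\<Sum>l = 1..2 * r. \<sigma> l * int l)
        = (\<Sum>l = 1..r. \<sigma> l * int l) + (\<Sum>l = r + 1..2 * r. \<sigma> l * int l)"
      using sum.ub_add_nat[of 1 r "\<lambda>l. \<sigma> l * int l" r] by (simp add: mult_2)
    ultimately have "(\<Sum>l = 1..2 * r. \<sigma> l * int l)
        = (\<Sum>i<r. - e i * int (r - i) + e i * int (r + 1 + i))"
      by (simp only: sum.distrib)
    also have "\<dots> = (\<Sum>i<r. e i * (2 * int i + 1))"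
      by (rule sum.cong) (auto simp: of_nat_diff algebra_simps)
    finally show ?thesis .
  qed
  have front: "(\<Sum>l = 1..2 * r + c. \<sigma> l * int l) = - int h"
  proof -
    have "\<sigma> (2 * r + 1) = e r" if "c = 1" using that by (simp add: \<sigma>_def)
    then show ?thesis using c pairs e(2) by (auto simp: algebra_simps)
  qed
  have "(\<Sum>l\<in>?L. \<sigma> l * int l)
      = (\<Sum>l = 1..2 * r + c. \<sigma> l * int l)
        + (\<Sum>l = Suc (2 * r + c)..2 * r + c + 2 * h. \<sigma> l * int l)"
    using sum.ub_add_nat[of 1 "2 * r + c" "\<lambda>l. \<sigma> l * int l" "2 * h"]
    by (simp add: k_eq add_ac)
  also have "(\<Sum>l = Suc (2 * r + c)..2 * r + c + 2 * h. \<sigma> l * int l)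
      = (\<Sum>l = Suc (2 * r + c)..2 * r + c + 2 * h. (-1) ^ (l + (2 * r + c)) * int l)"
    by (rule sum.cong) (auto simp: \<sigma>_def)
  also have "\<dots> = int h" by (rule alternating_tail)
  finally have zero: "(\<Sum>l\<in>?L. \<sigma> l * int l) = 0" using front by simp
  have "balanced_hubs r k S"
  proof
    fix l assume l: "1 \<le> l" "l \<le> 2 * r"
    have "\<sigma> (2 * r + 1 - l) = - \<sigma> l"
    proof (cases "l \<le> r")
      case True
      then have "2 * r + 1 - l - r - 1 = r - l" "\<not> 2 * r + 1 - l \<le> r" "2 * r + 1 - l \<le> 2 * r + c"
        using l by simp_all
      then show ?thesis using True by (simp only: \<sigma>_def if_True if_False minus_minus)
    next
      case False
      then have "r - (2 * r + 1 - l) = l - r - 1" "2 * r + 1 - l \<le> r" "l \<le> 2 * r + c"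
        using l by simp_all
      then show ?thesis using False by (simp only: \<sigma>_def if_True if_False)
    qed
    then show "2 * r + 1 - l \<in> S \<longleftrightarrow> l \<notin> S" using \<sigma>[of l] by (auto simp: S_def)
  next
    have "(\<Sum>l\<in>?L. \<sigma> l * int l)
        = (\<Sum>l\<in>?L \<inter> S. \<sigma> l * int l) + (\<Sum>l\<in>?L - S. \<sigma> l * int l)"
      by (rule sum.Int_Diff) simp
    also have "(\<Sum>l\<in>?L \<inter> S. \<sigma> l * int l) = (\<Sum>l\<in>?L \<inter> S. int l)"
      by (rule sum.cong) (auto simp: S_def)
    also have "(\<Sum>l\<in>?L - S. \<sigma> l * int l) = (\<Sum>l\<in>?L - S. - int l)"
    proof (rule sum.cong)
      fix l assume "l \<in> ?L - S"
      then show "\<sigma> l * int l = - int l" using \<sigma>[of l] by (auto simp: S_def)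
    qed simp
    finally have "int (\<Sum>(?L \<inter> S)) = int (\<Sum>(?L - S))"
      using zero by (simp add: sum_negf)
    then show "\<Sum>(?L \<inter> S) = \<Sum>(?L - S)" by (simp only: of_nat_eq_iff)
  qed (use r assms in auto)
  then show ?thesis using r by blast
qed

section \<open>The infinite family\<close>

text \<open>
  One graph is taken for each \<open>r\<close> that admits a balanced \<open>S\<close>. Its order is \<open>r + k + 2\<close>, so different
  values of \<open>r\<close> give nonisomorphic graphs.
\<close>

theorem theorem2p4:
  fixes k :: nat
  assumes "k \<ge> 1"
  shows "\<exists>\<G> :: nat pair_pre_digraph set.
    infinite \<G> \<and>
    (\<forall>G \<in> \<G>. \<forall>H \<in> \<G>. G \<noteq> H \<longrightarrow> \<not> digraph_iso (with_proj G) (with_proj H)) \<and>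
    (\<forall>G \<in> \<G>.
       pair_graph G \<and>
       Digraph_Component.connected (with_proj G) \<and>
       card (pverts G) \<ge> 3 \<and>
       card (pendant_vertices G) = k \<and>
       int k \<ge> int (chromatic_number G) - 1 \<and> int (chromatic_number G) - 1 \<ge> 1 \<and>
       local_antimagic_chromatic_number G = enat (k + 1))"
proof -
  define R where "R = {r. \<exists>S. balanced_hubs r k S}"
  have "\<forall>r\<in>R. \<exists>S. balanced_hubs r k S" by (simp add: R_def)
  from bchoice[OF this] obtain S where "\<forall>r\<in>R. balanced_hubs r k (S r)" ..
  then have S: "balanced_hubs r k (S r)" if "r \<in> R" for r using that by (rule bspec)
  define G where "G r = balanced_hubs.hub_graph r k (S r)" for r
  have "infinite R"
    unfolding infinite_nat_iff_unbounded_le R_def using balanced_hubs_exists[OF assms] by blast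
  have card_G: "card (pverts (G r)) = r + k + 2" if "r \<in> R" for r
    using balanced_hubs.card_pverts[OF S[OF that]] by (simp add: G_def)
  have "inj_on G R"
    by (rule inj_onI) (metis card_G add_right_cancel)
  then have "infinite (G ` R)" using \<open>infinite R\<close> finite_image_iff by blast
  moreover have "\<not> digraph_iso (with_proj (G r)) (with_proj (G s))"
    if "r \<in> R" "s \<in> R" "G r \<noteq> G s" for r s
    using digraph_iso_card_verts[of "with_proj (G r)" "with_proj (G s)"] card_G that by auto
  moreover have "pair_graph (G r) \<and> Digraph_Component.connected (with_proj (G r)) \<and>
      card (pverts (G r)) \<ge> 3 \<and> card (pendant_vertices (G r)) = k \<and>
      int k \<ge> int (chromatic_number (G r)) - 1 \<and> int (chromatic_number (G r)) - 1 \<ge> 1 \<and>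
      local_antimagic_chromatic_number (G r) = enat (k + 1)" if "r \<in> R" for r
  proof -
    interpret balanced_hubs r k "S r" by (rule S[OF that])
    show ?thesis
      unfolding G_def
      using pair_graph_hub_graph connected_hub_graph card_pverts pendant_vertices_hub_graph
        chromatic_number_hub_graph local_antimagic_chromatic_number_hub_graph k by simp
  qed
  ultimately show ?thesis by (intro exI[of _ "G ` R"]) blast
qed

end
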